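(* Let $B$ be a unital $C^*$-algebra, $A$ a $C^*$-subalgebra of $B$ with a common unit, and $E$ a conditional expectation of $B$ onto $A$ with $\mathrm{Index}\,E=2$. Let $C^*\langle B,e_A\rangle$ be the basic construction with Jones projection $e_A$. Then the following conditions are equivalent: (1) $e_A$ and $1-e_A$ are (Murray--von Neumann) equivalent in $C^*\langle B,e_A\rangle$; (2) there exists a unitary element $u\in B$ such that $\{(1,1),(u,u^* )\}$ is a quasi-basis for $E$; (3) there exists a $2\mathbb{Z}$-inner $C^*$-dynamical system $(A,\mathbb{Z},\alpha)$ such that $X_\alpha\sim X_B$, i.e. $X_\alpha$ and $X_B$ are isomorphic as involutive $A$-$A$-equivalence bimodules.
   Context: Index: A quasi-basis for a conditional expectation $E:B\to A$ is a finite family $\{(u_i,v_i)\}\subset B\times B$ with $x=\sum_i u_iE(v_ix)=\sum_i E(xu_i)v_i$ for all $x\in B$; then $\mathrm{Index}\,E=\sum_i u_iv_i$ (independent of the quasi-basis). "$\mathrm{Index}\,E=2$" means a quasi-basis exists and $\mathrm{Index}\,E=2\cdot1$. Basic construction: $B$ is a right Hilbert $A$-module with $\langle x,y\rangle=E(x^*y)$; $B$ acts on it by left multiplication, and the Jones projection is $e_A(x)=E(x)$. $C^*\langle B,e_A\rangle$ is the $C^*$-algebra of adjointable operators generated by $B$ and $e_A$ (it is the linear span of $\{be_Ac: b,c\in B\}$). Equivalence bimodules: An $A$-$A$-equivalence bimodule $X$ is an $A$-$A$-bimodule with left and right $A$-valued inner products ${}_A\langle\cdot,\cdot\rangle$,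 $\langle\cdot,\cdot\rangle_A$ making it a full left and a full right Hilbert $A$-module, each action being adjointable for the inner product on the other side, with ${}_A\langle x,y\rangle\cdot z=x\cdot\langle y,z\rangle_A$. It is involutive if equipped with a conjugate linear map $x\mapsto x^\sharp$ with $(x^\sharp)^\sharp=x$, $(a\cdot x\cdot b)^\sharp=b^*\cdot x^\sharp\cdot a^*$, ${}_A\langle x,y^\sharp\rangle=\langle x^\sharp,y\rangle_A$. For involutive bimodules, $X\sim Y$ means that there is a bijective bimodule map $\rho:X\to Y$ preserving both inner products with $\rho(x^\sharp)=\rho(x)^\sharp$. The bimodule $X_B$: When $\mathrm{Index}\,E=2$ there is a unique automorphism $\widehat\beta$ of $C^*\langle B,e_A\rangle$ with $\widehat\beta(b)=b$ for $b\in B$ and $\widehat\beta(e_A)=1-e_A$; it satisfies $\widehat\beta^2=\mathrm{id}$. Moreover $a\mapsto ae_A$ is an isomorphism of $A$ onto $e_AC^*\langle B,e_A\rangle e_A$ and $a\mapsto a(1-e_A)$ is an isomorphism of $A$ onto $(1-e_A)C^*\langle B,e_A\rangle(1-e_A)$. Put $X_B=e_AC^*\langle B,e_A\rangle(1-e_A)$, with $a\cdot x\cdot b=axb$, ${}_A\langle x,y\rangle$ the unique $c\in A$ with $ce_A=xy^*$, $\langle x,y\rangle_A$ the unique $c\in A$ with $c(1-e_A)=x^*y$, and involution $x^\sharp=\widehat\beta(x^* )$. The bimodule $X_\alpha$: A $2\mathbb{Z}$-inner $C^*$-dynamical system $(A,\mathbb{Z},\alpha)$ is given by an automorphism $\alpha$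 of $A$ for which there is a unitary $z\in A$ with $\alpha(z)=z$ and $\alpha^2=\mathrm{Ad}(z)$, i.e. $\alpha^2(a)=zaz^*$ (such a $z$ is fixed as part of the data). $X_\alpha$ is the vector space $A$ with $a\cdot x=ax$, ${}_A\langle x,y\rangle=xy^*$, $x\cdot a=x\alpha(a)$, $\langle x,y\rangle_A=\alpha^{-1}(x^*y)$, and involution $x^\sharp=z^*\alpha(x^* )$. *)

theory Defs
  imports Complex_Main
begin

section \<open>Unital C*-algebras\<close>

text \<open>The norm axioms inherited from \<^class>\<open>real_normed_algebra_1\<close> include
  submultiplicativity and \<open>norm 1 = 1\<close>; in particular the zero algebra is excluded.\<close>

class unital_cstar_algebra = real_normed_algebra_1 + complete_space +
  fixes scaleC :: "complex \<Rightarrow> 'a \<Rightarrow> 'a"  (infixr "*\<^sub>C" 75)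
    and star :: "'a \<Rightarrow> 'a"  ("_\<^sup>\<star>" [1000] 999)
  assumes scaleC_add_right: "c *\<^sub>C (x + y) = c *\<^sub>C x + c *\<^sub>C y"
    and scaleC_add_left: "(c + d) *\<^sub>C x = c *\<^sub>C x + d *\<^sub>C x"
    and scaleC_scaleC: "c *\<^sub>C d *\<^sub>C x = (c * d) *\<^sub>C x"
    and scaleR_scaleC: "r *\<^sub>R x = complex_of_real r *\<^sub>C x"
    and mult_scaleC_left: "(c *\<^sub>C x) * y = c *\<^sub>C (x * y)"
    and mult_scaleC_right: "x * (c *\<^sub>C y) = c *\<^sub>C (x * y)"
    and norm_scaleC: "norm (c *\<^sub>C x) = cmod c * norm x"
    and star_star: "(x\<^sup>\<star>)\<^sup>\<star> = x"
    and star_add: "(x + y)\<^sup>\<star> = x\<^sup>\<star> + y\<^sup>\<star>"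
    and star_scaleC: "(c *\<^sub>C x)\<^sup>\<star> = cnj c *\<^sub>C x\<^sup>\<star>"
    and star_mult: "(x * y)\<^sup>\<star> = y\<^sup>\<star> * x\<^sup>\<star>"
    and norm_star_mult_self: "norm (x\<^sup>\<star> * x) = (norm x)\<^sup>2"

definition unitary :: "'b::unital_cstar_algebra \<Rightarrow> bool" where
  "unitary u \<longleftrightarrow> u\<^sup>\<star> * u = 1 \<and> u * u\<^sup>\<star> = 1"

definition unital_cstar_subalgebra :: "'b::unital_cstar_algebra set \<Rightarrow> bool" where
  "unital_cstar_subalgebra A \<longleftrightarrow>
     1 \<in> A \<and> closed A \<and>
     (\<forall>x\<in>A. \<forall>y\<in>A. x + y \<in> A \<and> x * y \<in> A) \<and>
     (\<forall>c. \<forall>x\<in>A. c *\<^sub>C x \<in> A) \<and>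
     (\<forall>x\<in>A. x\<^sup>\<star> \<in> A)"

text \<open>*-automorphisms of a *-algebra given by its carrier \<open>M\<close> and its operations. This is used
  both for subalgebras of a C*-algebra and for algebras of operators.\<close>

definition star_automorphism ::
  "'m set \<Rightarrow> ('m \<Rightarrow> 'm \<Rightarrow> 'm) \<Rightarrow> (complex \<Rightarrow> 'm \<Rightarrow> 'm) \<Rightarrow> ('m \<Rightarrow> 'm \<Rightarrow> 'm) \<Rightarrow> ('m \<Rightarrow> 'm)
    \<Rightarrow> ('m \<Rightarrow> 'm) \<Rightarrow> bool" where
  "star_automorphism M add scale mult adjoint \<phi> \<longleftrightarrow>
     bij_betw \<phi> M M \<and>
     (\<forall>x\<in>M. \<forall>y\<in>M. \<phi> (add x y) = add (\<phi> x) (\<phi> y)) \<and>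
     (\<forall>c. \<forall>x\<in>M. \<phi> (scale c x) = scale c (\<phi> x)) \<and>
     (\<forall>x\<in>M. \<forall>y\<in>M. \<phi> (mult x y) = mult (\<phi> x) (\<phi> y)) \<and>
     (\<forall>x\<in>M. \<phi> (adjoint x) = adjoint (\<phi> x))"


section \<open>Conditional expectations, quasi-bases and the index\<close>

text \<open>A positive contractive projection onto \<open>A\<close> that is an \<open>A\<close>-\<open>A\<close>-bimodule map.
  Positivity is that of \<open>E\<close> as a map into the C*-algebra \<open>A\<close>, whose positive
  elements are those of the form \<open>y\<^sup>\<star> * y\<close> with \<open>y \<in> A\<close>. Faithfulness is not assumed.\<close>

definition conditional_expectation ::
  "'b::unital_cstar_algebra set \<Rightarrow> ('b \<Rightarrow> 'b) \<Rightarrow> bool" where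
  "conditional_expectation A E \<longleftrightarrow>
     (\<forall>x y. E (x + y) = E x + E y) \<and>
     (\<forall>c x. E (c *\<^sub>C x) = c *\<^sub>C E x) \<and>
     (\<forall>x. E x \<in> A) \<and>
     (\<forall>a\<in>A. E a = a) \<and>
     (\<forall>a\<in>A. \<forall>b\<in>A. \<forall>x. E (a * x * b) = a * E x * b) \<and>
     (\<forall>x. \<exists>y\<in>A. E (x\<^sup>\<star> * x) = y\<^sup>\<star> * y) \<and>
     (\<forall>x. norm (E x) \<le> norm x)"

text \<open>Finite families of pairs are rendered as lists, so that repetitions are allowed.\<close>

definition quasi_basis :: "('b::unital_cstar_algebra \<Rightarrow> 'b) \<Rightarrow> ('b \<times> 'b) list \<Rightarrow> bool" where
  "quasi_basis E uvs \<longleftrightarrow>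
     (\<forall>x. x = (\<Sum>(u, v)\<leftarrow>uvs. u * E (v * x)) \<and>
          x = (\<Sum>(u, v)\<leftarrow>uvs. E (x * u) * v))"

definition index_finite :: "('b::unital_cstar_algebra \<Rightarrow> 'b) \<Rightarrow> bool" where
  "index_finite E \<longleftrightarrow> (\<exists>uvs. quasi_basis E uvs)"

text \<open>The value does not depend on the chosen quasi-basis; it is meaningful only
  when \<^term>\<open>index_finite E\<close> holds.\<close>

definition Index :: "('b::unital_cstar_algebra \<Rightarrow> 'b) \<Rightarrow> 'b" where
  "Index E = (\<Sum>(u, v)\<leftarrow>(SOME uvs. quasi_basis E uvs). u * v)"


section \<open>The basic construction\<close>

text \<open>The whole algebra \<open>B\<close> (the type) is a right Hilbert module over the range of \<open>E\<close>.
  Operators on it are plain functions; composition is the product.\<close>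

definition hm_inner :: "('b::unital_cstar_algebra \<Rightarrow> 'b) \<Rightarrow> 'b \<Rightarrow> 'b \<Rightarrow> 'b" where
  "hm_inner E x y = E (x\<^sup>\<star> * y)"

definition hm_norm :: "('b::unital_cstar_algebra \<Rightarrow> 'b) \<Rightarrow> 'b \<Rightarrow> real" where
  "hm_norm E x = sqrt (norm (hm_inner E x x))"

definition is_adjoint ::
  "('b::unital_cstar_algebra \<Rightarrow> 'b) \<Rightarrow> ('b \<Rightarrow> 'b) \<Rightarrow> ('b \<Rightarrow> 'b) \<Rightarrow> bool" where
  "is_adjoint E T S \<longleftrightarrow> (\<forall>x y. hm_inner E (T x) y = hm_inner E x (S y))"

definition adjointable :: "('b::unital_cstar_algebra \<Rightarrow> 'b) \<Rightarrow> ('b \<Rightarrow> 'b) set" where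
  "adjointable E = {T. \<exists>S. is_adjoint E T S}"

definition adj :: "('b::unital_cstar_algebra \<Rightarrow> 'b) \<Rightarrow> ('b \<Rightarrow> 'b) \<Rightarrow> ('b \<Rightarrow> 'b)" where
  "adj E T = (THE S. is_adjoint E T S)"

definition op_add :: "('b::unital_cstar_algebra \<Rightarrow> 'b) \<Rightarrow> ('b \<Rightarrow> 'b) \<Rightarrow> ('b \<Rightarrow> 'b)" where
  "op_add S T = (\<lambda>x. S x + T x)"

definition op_scale :: "complex \<Rightarrow> ('b::unital_cstar_algebra \<Rightarrow> 'b) \<Rightarrow> ('b \<Rightarrow> 'b)" where
  "op_scale c T = (\<lambda>x. c *\<^sub>C T x)"

definition left_mult :: "'b::unital_cstar_algebra \<Rightarrow> ('b \<Rightarrow> 'b)" where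
  "left_mult b = (\<lambda>x. b * x)"

definition jones_projection :: "('b::unital_cstar_algebra \<Rightarrow> 'b) \<Rightarrow> ('b \<Rightarrow> 'b)" where
  "jones_projection E = (\<lambda>x. E x)"

definition jones_complement :: "('b::unital_cstar_algebra \<Rightarrow> 'b) \<Rightarrow> ('b \<Rightarrow> 'b)" where
  "jones_complement E = (\<lambda>x. x - jones_projection E x)"

text \<open>The last conjunct says that \<open>M\<close> is closed in the operator norm
  on the adjointable operators.\<close>

definition operator_cstar_algebra ::
  "('b::unital_cstar_algebra \<Rightarrow> 'b) \<Rightarrow> ('b \<Rightarrow> 'b) set \<Rightarrow> bool" where
  "operator_cstar_algebra E M \<longleftrightarrow>
     M \<subseteq> adjointable E \<and>
     (\<lambda>x. 0) \<in> M \<and>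
     (\<forall>S\<in>M. \<forall>T\<in>M. op_add S T \<in> M \<and> S \<circ> T \<in> M) \<and>
     (\<forall>c. \<forall>T\<in>M. op_scale c T \<in> M) \<and>
     (\<forall>T\<in>M. adj E T \<in> M) \<and>
     (\<forall>T\<in>adjointable E.
        (\<forall>\<epsilon>>0. \<exists>S\<in>M. \<forall>x. hm_norm E (T x - S x) \<le> \<epsilon> * hm_norm E x) \<longrightarrow> T \<in> M)"

definition basic_construction :: "('b::unital_cstar_algebra \<Rightarrow> 'b) \<Rightarrow> ('b \<Rightarrow> 'b) set" where
  "basic_construction E =
     operator_cstar_algebra E hull (insert (jones_projection E) (range left_mult))"

definition murray_von_neumann_equivalent ::
  "('b::unital_cstar_algebra \<Rightarrow> 'b) \<Rightarrow> ('b \<Rightarrow> 'b) set \<Rightarrow> ('b \<Rightarrow> 'b) \<Rightarrow> ('b \<Rightarrow> 'b) \<Rightarrow> bool" where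
  "murray_von_neumann_equivalent E M p q \<longleftrightarrow> (\<exists>v\<in>M. adj E v \<circ> v = p \<and> v \<circ> adj E v = q)"

text \<open>For index 2 this automorphism exists and its restriction to the basic construction
  is unique; its values elsewhere are arbitrary and never used.\<close>

definition beta_hat ::
  "('b::unital_cstar_algebra \<Rightarrow> 'b) \<Rightarrow> ('b \<Rightarrow> 'b) \<Rightarrow> ('b \<Rightarrow> 'b)" where
  "beta_hat E = (SOME \<phi>.
     star_automorphism (basic_construction E) op_add op_scale (\<circ>) (adj E) \<phi> \<and>
     (\<forall>b. \<phi> (left_mult b) = left_mult b) \<and>
     \<phi> (jones_projection E) = jones_complement E)"


section \<open>Involutive bimodules\<close>

text \<open>The data of an involutive \<open>A\<close>-\<open>A\<close>-equivalence bimodule, with \<open>'a\<close> the type of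
  the coefficients and \<open>'x\<close> the type of the vectors.\<close>

record ('a, 'x) involutive_bimodule =
  vectors :: "'x set"
  vadd :: "'x \<Rightarrow> 'x \<Rightarrow> 'x"
  vscale :: "complex \<Rightarrow> 'x \<Rightarrow> 'x"
  lact :: "'a \<Rightarrow> 'x \<Rightarrow> 'x"
  ract :: "'x \<Rightarrow> 'a \<Rightarrow> 'x"
  linner :: "'x \<Rightarrow> 'x \<Rightarrow> 'a"
  rinner :: "'x \<Rightarrow> 'x \<Rightarrow> 'a"
  sharp :: "'x \<Rightarrow> 'x"

definition involutive_bimodule_iso ::
  "'a set \<Rightarrow> ('a, 'x) involutive_bimodule \<Rightarrow> ('a, 'y) involutive_bimodule \<Rightarrow> bool" where
  "involutive_bimodule_iso A X Y \<longleftrightarrow>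
     (\<exists>\<rho>. bij_betw \<rho> (vectors X) (vectors Y) \<and>
       (\<forall>x\<in>vectors X. \<forall>y\<in>vectors X. \<rho> (vadd X x y) = vadd Y (\<rho> x) (\<rho> y)) \<and>
       (\<forall>c. \<forall>x\<in>vectors X. \<rho> (vscale X c x) = vscale Y c (\<rho> x)) \<and>
       (\<forall>a\<in>A. \<forall>x\<in>vectors X. \<rho> (lact X a x) = lact Y a (\<rho> x)) \<and>
       (\<forall>a\<in>A. \<forall>x\<in>vectors X. \<rho> (ract X x a) = ract Y (\<rho> x) a) \<and>
       (\<forall>x\<in>vectors X. \<forall>y\<in>vectors X. linner Y (\<rho> x) (\<rho> y) = linner X x y) \<and>
       (\<forall>x\<in>vectors X. \<forall>y\<in>vectors X. rinner Y (\<rho> x) (\<rho> y) = rinner X x y) \<and>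
       (\<forall>x\<in>vectors X. \<rho> (sharp X x) = sharp Y (\<rho> x)))"

definition bimodule_of_inclusion ::
  "'b::unital_cstar_algebra set \<Rightarrow> ('b \<Rightarrow> 'b) \<Rightarrow> ('b, 'b \<Rightarrow> 'b) involutive_bimodule" where
  "bimodule_of_inclusion A E = \<lparr>
     vectors = {jones_projection E \<circ> T \<circ> jones_complement E | T. T \<in> basic_construction E},
     vadd = op_add,
     vscale = op_scale,
     lact = (\<lambda>a x. left_mult a \<circ> x),
     ract = (\<lambda>x a. x \<circ> left_mult a),
     linner = (\<lambda>x y. THE c. c \<in> A \<and> left_mult c \<circ> jones_projection E = x \<circ> adj E y),
     rinner = (\<lambda>x y. THE c. c \<in> A \<and> left_mult c \<circ> jones_complement E = adj E x \<circ> y),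
     sharp = (\<lambda>x. beta_hat E (adj E x)) \<rparr>"

definition two_Z_inner_system ::
  "'b::unital_cstar_algebra set \<Rightarrow> ('b \<Rightarrow> 'b) \<Rightarrow> 'b \<Rightarrow> bool" where
  "two_Z_inner_system A \<alpha> z \<longleftrightarrow>
     star_automorphism A (+) scaleC (*) star \<alpha> \<and>
     z \<in> A \<and> unitary z \<and> \<alpha> z = z \<and>
     (\<forall>a\<in>A. \<alpha> (\<alpha> a) = z * a * z\<^sup>\<star>)"

definition bimodule_of_automorphism ::
  "'b::unital_cstar_algebra set \<Rightarrow> ('b \<Rightarrow> 'b) \<Rightarrow> 'b \<Rightarrow> ('b, 'b) involutive_bimodule" where
  "bimodule_of_automorphism A \<alpha> z = \<lparr>
     vectors = A,
     vadd = (+),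
     vscale = scaleC,
     lact = (*),
     ract = (\<lambda>x a. x * \<alpha> a),
     linner = (\<lambda>x y. x * y\<^sup>\<star>),
     rinner = (\<lambda>x y. the_inv_into A \<alpha> (x\<^sup>\<star> * y)),
     sharp = (\<lambda>x. z\<^sup>\<star> * \<alpha> (x\<^sup>\<star>)) \<rparr>"

end

theory Submission
  imports Defs
begin

text \<open>Each of the three conditions produces an element \<open>u\<close> with \<open>E (u\<^sup>\<star> * u) = 1\<close> and
  \<open>x = E x + u * E (u\<^sup>\<star> * x)\<close>: for a partial isometry \<open>v\<close> from \<open>e\<^sub>A\<close> to \<open>1 - e\<^sub>A\<close> take \<open>u = v 1\<close>, and
  for a bimodule isomorphism \<open>\<rho>\<close> take \<open>u = (\<rho> 1)\<^sup>\<star> 1\<close>. Index 2 forces such a \<open>u\<close> to be unitary.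
  Conversely, a unitary \<open>u\<close> as in (2) satisfies \<open>E u = 0\<close> and \<open>u * u \<in> A\<close>, and it normalizes \<open>A\<close>; then
  \<open>u e\<^sub>A\<close> is a partial isometry as in (1), and \<open>a \<mapsto> e\<^sub>A a u\<^sup>\<star>\<close> is an isomorphism as in (3)
  for \<open>\<alpha> a = u\<^sup>\<star> * a * u\<close> and \<open>z = (u * u)\<^sup>\<star>\<close>. The dual automorphism is conjugation by right
  multiplication with \<open>u\<^sup>\<star>\<close>.\<close>

section \<open>Elementary identities for the involution and scalars\<close>

lemma scaleC_one: "1 *\<^sub>C (x::'b::unital_cstar_algebra) = x"
  using scaleR_scaleC[of 1 x] by simp

lemma scaleC_minus_one: "(-1) *\<^sub>C (x::'b::unital_cstar_algebra) = - x"
  using scaleR_scaleC[of "-1" x] by simp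

lemma star_zero: "(0::'b::unital_cstar_algebra)\<^sup>\<star> = 0"
  using star_add[of 0 0] by simp

lemma star_minus: "(- x)\<^sup>\<star> = - ((x::'b::unital_cstar_algebra)\<^sup>\<star>)"
  using star_scaleC[of "-1" x] by (simp add: scaleC_minus_one)

lemma star_diff: "(x - y)\<^sup>\<star> = (x::'b::unital_cstar_algebra)\<^sup>\<star> - y\<^sup>\<star>"
  using star_add[of x "- y"] by (simp add: star_minus)

lemma star_one: "(1::'b::unital_cstar_algebra)\<^sup>\<star> = 1"
  by (metis mult_1 mult_1_right star_mult star_star)

lemma sum_list_swap:
  fixes f :: "'c \<Rightarrow> 'd \<Rightarrow> 'e::comm_monoid_add"
  shows "(\<Sum>x\<leftarrow>xs. \<Sum>y\<leftarrow>ys. f x y) = (\<Sum>y\<leftarrow>ys. \<Sum>x\<leftarrow>xs. f x y)"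
  by (induction xs) (simp_all add: sum_list_addf)

section \<open>Conditional expectations and the adjoint relation\<close>

locale cond_exp =
  fixes A :: "'b::unital_cstar_algebra set" and E :: "'b \<Rightarrow> 'b"
  assumes subalgebra: "unital_cstar_subalgebra A"
    and cond_exp: "conditional_expectation A E"
begin

lemma A_simps [simp]:
  "1 \<in> A" "x \<in> A \<Longrightarrow> y \<in> A \<Longrightarrow> x + y \<in> A" "x \<in> A \<Longrightarrow> y \<in> A \<Longrightarrow> x * y \<in> A"
  "x \<in> A \<Longrightarrow> c *\<^sub>C x \<in> A" "x \<in> A \<Longrightarrow> x\<^sup>\<star> \<in> A"
  using subalgebra by (auto simp: unital_cstar_subalgebra_def)

lemma E_simps [simp]:
  "E (x + y) = E x + E y" "E (c *\<^sub>C x) = c *\<^sub>C E x" "E x \<in> A" "a \<in> A \<Longrightarrow> E a = a"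
  using cond_exp by (auto simp: conditional_expectation_def)

lemma E_mult_left [simp]: "a \<in> A \<Longrightarrow> E (a * x) = a * E x"
  and E_mult_right [simp]: "a \<in> A \<Longrightarrow> E (x * a) = E x * a"
proof -
  have *: "E (a * x * b) = a * E x * b" if "a \<in> A" "b \<in> A" for a b x
    using cond_exp that by (auto simp: conditional_expectation_def)
  show "a \<in> A \<Longrightarrow> E (a * x) = a * E x" using *[of a 1] by simp
  show "a \<in> A \<Longrightarrow> E (x * a) = E x * a" using *[of 1 a] by simp
qed

lemma E_uminus [simp]: "E (- x) = - E x"
  using E_simps(2)[of "-1" x] by (simp only: scaleC_minus_one)

lemma E_diff [simp]: "E (x - y) = E x - E y"
  using E_simps(1)[of x "- y"] by simp

lemma E_zero [simp]: "E 0 = 0"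
  using E_diff[of 0 0] by simp

lemma E_one [simp]: "E 1 = 1"
  by simp

text \<open>Positivity makes \<open>E (x\<^sup>\<star> * x)\<close> self-adjoint; polarize with \<open>1 + x\<close> and \<open>1 + \<i>x\<close>.\<close>

lemma E_star: "E (x\<^sup>\<star>) = (E x)\<^sup>\<star>"
proof -
  have sa: "(E (y\<^sup>\<star> * y))\<^sup>\<star> = E (y\<^sup>\<star> * y)" for y
  proof -
    obtain w where "E (y\<^sup>\<star> * y) = w\<^sup>\<star> * w"
      using cond_exp by (auto simp: conditional_expectation_def)
    then show ?thesis by (simp add: star_mult star_star)
  qed
  have sum: "(E y)\<^sup>\<star> + (E (y\<^sup>\<star>))\<^sup>\<star> = E y + E (y\<^sup>\<star>)" for y
  proof -
    have "(1 + y)\<^sup>\<star> * (1 + y) = 1 + y + y\<^sup>\<star> + y\<^sup>\<star> * y"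
      by (simp add: star_add star_one algebra_simps)
    then have "E ((1 + y)\<^sup>\<star> * (1 + y)) = 1 + E y + E (y\<^sup>\<star>) + E (y\<^sup>\<star> * y)"
      by simp
    with sa[of "1 + y"] sa[of y] show ?thesis
      by (simp add: star_add star_one)
  qed
  \<comment> \<open>This is \<open>sum\<close> at \<open>\<i> *\<^sub>C x\<close>; multiplying it by
    \<open>\<i>\<close> turns the sums into differences.\<close>
  have "- \<i> *\<^sub>C (E x)\<^sup>\<star> + \<i> *\<^sub>C (E (x\<^sup>\<star>))\<^sup>\<star> = \<i> *\<^sub>C E x + (- \<i>) *\<^sub>C E (x\<^sup>\<star>)"
    using sum[of "\<i> *\<^sub>C x"] by (simp add: star_scaleC)
  then have "\<i> *\<^sub>C (- \<i> *\<^sub>C (E x)\<^sup>\<star> + \<i> *\<^sub>C (E (x\<^sup>\<star>))\<^sup>\<star>)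
    = \<i> *\<^sub>C (\<i> *\<^sub>C E x + (- \<i>) *\<^sub>C E (x\<^sup>\<star>))" by simp
  then have "(E x)\<^sup>\<star> - (E (x\<^sup>\<star>))\<^sup>\<star> = - E x + E (x\<^sup>\<star>)"
    by (simp add: scaleC_add_right scaleC_scaleC scaleC_one scaleC_minus_one)
  \<comment> \<open>Adding the two relations cancels
    \<open>(E (x\<^sup>\<star>))\<^sup>\<star>\<close> on the left and \<open>E x\<close> on the
    right, leaving twice the claim.\<close>
  then have "((E x)\<^sup>\<star> + (E (x\<^sup>\<star>))\<^sup>\<star>) + ((E x)\<^sup>\<star> - (E (x\<^sup>\<star>))\<^sup>\<star>)
    = (E x + E (x\<^sup>\<star>)) + (- E x + E (x\<^sup>\<star>))"
    by (simp only: sum)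
  then have "(E x)\<^sup>\<star> + (E x)\<^sup>\<star> = E (x\<^sup>\<star>) + E (x\<^sup>\<star>)"
    by simp
  then have "(2::real) *\<^sub>R (E x)\<^sup>\<star> = (2::real) *\<^sub>R E (x\<^sup>\<star>)"
    by (simp add: scaleR_2)
  then show ?thesis by simp
qed

lemma adjointableI: "is_adjoint E T S \<Longrightarrow> T \<in> adjointable E"
  by (auto simp: adjointable_def)

text \<open>Since \<open>E\<close> commutes with the star, the inner product is conjugate symmetric,
  so the relation can be starred.\<close>

lemma is_adjoint_sym: "is_adjoint E T S \<Longrightarrow> is_adjoint E S T"
  unfolding is_adjoint_def hm_inner_def
  by (metis E_star star_mult star_star)

lemma is_adjoint_E: "is_adjoint E E E"
  by (simp add: is_adjoint_def hm_inner_def E_star[symmetric])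

lemma is_adjoint_jones: "is_adjoint E (jones_projection E) (jones_projection E)"
  using is_adjoint_E by (simp add: jones_projection_def)

lemma is_adjoint_complement: "is_adjoint E (jones_complement E) (jones_complement E)"
  by (simp add: is_adjoint_def hm_inner_def jones_complement_def jones_projection_def
      E_star[symmetric] star_diff algebra_simps)

lemma is_adjoint_left_mult: "is_adjoint E (left_mult b) (left_mult (b\<^sup>\<star>))"
  by (simp add: is_adjoint_def hm_inner_def left_mult_def star_mult mult.assoc)

lemma is_adjoint_comp:
  "is_adjoint E T T' \<Longrightarrow> is_adjoint E S S' \<Longrightarrow> is_adjoint E (T \<circ> S) (S' \<circ> T')"
  by (simp add: is_adjoint_def)

lemma is_adjoint_add:
  "is_adjoint E T T' \<Longrightarrow> is_adjoint E S S' \<Longrightarrow> is_adjoint E (op_add T S) (op_add T' S')"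
  by (simp add: is_adjoint_def hm_inner_def op_add_def star_add distrib_left distrib_right)

lemma is_adjoint_scale:
  "is_adjoint E T T' \<Longrightarrow> is_adjoint E (op_scale c T) (op_scale (cnj c) T')"
  by (simp add: is_adjoint_def hm_inner_def op_scale_def star_scaleC
      mult_scaleC_left mult_scaleC_right)

lemma complement_apply: "jones_complement E x = x - E x"
  by (simp add: jones_complement_def jones_projection_def)

end

section \<open>Finite index: adjointable operators, the basic construction and the index\<close>

locale finite_index_cond_exp = cond_exp +
  assumes finite_index: "index_finite E"
begin

text \<open>Every coefficient \<open>E (v * y)\<close> in the quasi-basis expansion of
  \<open>y\<close> vanishes. This is the form in which faithfulness enters below.\<close>

lemma nondegenerate:
  assumes "\<And>x. E (x * y) = 0"
  shows "y = 0"
proof -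
  obtain uvs where "quasi_basis E uvs"
    using finite_index by (auto simp: index_finite_def)
  then have "y = (\<Sum>(u, v)\<leftarrow>uvs. u * E (v * y))"
    by (simp add: quasi_basis_def)
  with assms show ?thesis by (simp add: split_def)
qed

lemma hm_inner_eqI:
  assumes "\<And>x. hm_inner E x y = hm_inner E x z"
  shows "y = z"
proof -
  have "E (x * (y - z)) = 0" for x
    using assms[of "x\<^sup>\<star>"] by (simp add: hm_inner_def star_star right_diff_distrib)
  then have "y - z = 0" by (rule nondegenerate)
  then show ?thesis by simp
qed

text \<open>Nondegeneracy makes adjoints unique, so the description in \<open>adj\<close> is well
  defined and an adjoint is computed by exhibiting one.\<close>

lemma adj_eqI:
  assumes "is_adjoint E T S"
  shows "adj E T = S"
  unfolding adj_def
proof (rule the_equality[where P = "is_adjoint E T", OF assms])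
  show "S' = S" if "is_adjoint E T S'" for S'
  proof (rule ext, rule hm_inner_eqI)
    show "hm_inner E x (S' y) = hm_inner E x (S y)" for x y
      using assms that unfolding is_adjoint_def by metis
  qed
qed

lemma is_adjoint_adj: "T \<in> adjointable E \<Longrightarrow> is_adjoint E T (adj E T)"
proof -
  assume "T \<in> adjointable E"
  then obtain S where S: "is_adjoint E T S" by (auto simp: adjointable_def)
  then show ?thesis by (simp only: adj_eqI[OF S])
qed

text \<open>Operators are plain functions, so linearity has to come from the adjoint: the pairing of
  \<open>z\<close> with \<open>T x\<close> equals that of \<open>S z\<close> with \<open>x\<close>,
  which is additive and right \<open>A\<close>-linear in \<open>x\<close>.\<close>

lemma adjointable_linear:
  assumes "T \<in> adjointable E"
  shows "T (x + y) = T x + T y"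
    and "a \<in> A \<Longrightarrow> T (x * a) = T x * a"
proof -
  obtain S where "is_adjoint E S T"
    using assms is_adjoint_sym by (auto simp: adjointable_def)
  then have S: "hm_inner E z (T x) = hm_inner E (S z) x" for z x
    by (simp add: is_adjoint_def)
  show "T (x + y) = T x + T y"
  proof (rule hm_inner_eqI)
    fix z
    have "hm_inner E z (T x + T y) = hm_inner E z (T x) + hm_inner E z (T y)"
      by (simp add: hm_inner_def distrib_left)
    then show "hm_inner E z (T (x + y)) = hm_inner E z (T x + T y)"
      unfolding S by (simp add: hm_inner_def distrib_left)
  qed
  show "T (x * a) = T x * a" if "a \<in> A"
  proof (rule hm_inner_eqI)
    fix z
    have "hm_inner E z (T x * a) = hm_inner E z (T x) * a"
      using that by (simp add: hm_inner_def mult.assoc[symmetric])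
    then show "hm_inner E z (T (x * a)) = hm_inner E z (T x * a)"
      unfolding S using that by (simp add: hm_inner_def mult.assoc[symmetric])
  qed
qed

lemma adjointable_on_A: "T \<in> adjointable E \<Longrightarrow> a \<in> A \<Longrightarrow> T a = T 1 * a"
  using adjointable_linear(2)[of T a 1] by simp

lemma adjointable_zero: "T \<in> adjointable E \<Longrightarrow> T 0 = 0"
  using adjointable_linear(1)[of T 0 0] by simp

text \<open>Applying \<open>T\<close> termwise to the expansion of \<open>x\<close> exhibits
  \<open>T\<close> as the finite sum of the operators \<open>(T u) e\<^sub>A v\<close>.\<close>

lemma adjointable_expansion:
  assumes "T \<in> adjointable E" "quasi_basis E uvs"
  shows "T x = (\<Sum>(u, v)\<leftarrow>uvs. T u * E (v * x))"
proof -
  have "T (\<Sum>(u, v)\<leftarrow>l. u * E (v * x)) = (\<Sum>(u, v)\<leftarrow>l. T u * E (v * x))" for l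
    using assms(1) by (induction l) (auto simp: adjointable_linear adjointable_zero)
  with assms(2) show ?thesis by (metis quasi_basis_def)
qed

text \<open>The adjointable operators form a C*-algebra containing the generators. Conversely, by
  the finite expansion, each of them lies in every algebra that contains \<open>e\<^sub>A\<close>
  and the left multiplications.\<close>

lemma basic_construction_eq: "basic_construction E = adjointable E"
proof
  have "operator_cstar_algebra E (adjointable E)"
    unfolding operator_cstar_algebra_def
  proof (intro conjI ballI allI impI)
    show "(\<lambda>x. 0) \<in> adjointable E"
      by (auto simp: adjointable_def is_adjoint_def hm_inner_def star_zero intro!: exI[of _ "\<lambda>x. 0"])
    show "adj E T \<in> adjointable E" if "T \<in> adjointable E" for T
      using is_adjoint_sym[OF is_adjoint_adj[OF that]] by (auto simp: adjointable_def)
    show "op_add S T \<in> adjointable E" "S \<circ> T \<in> adjointable E"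
      if "S \<in> adjointable E" "T \<in> adjointable E" for S T
      using is_adjoint_add[OF that[THEN is_adjoint_adj]] is_adjoint_comp[OF that[THEN is_adjoint_adj]]
      by (auto simp: adjointable_def)
    show "op_scale c T \<in> adjointable E" if "T \<in> adjointable E" for c T
      using is_adjoint_scale[OF is_adjoint_adj[OF that]] by (auto simp: adjointable_def)
  qed simp_all
  moreover have "insert (jones_projection E) (range left_mult) \<subseteq> adjointable E"
    using is_adjoint_jones is_adjoint_left_mult by (auto simp: adjointable_def)
  ultimately show "basic_construction E \<subseteq> adjointable E"
    unfolding basic_construction_def by (intro hull_minimal)
  show "adjointable E \<subseteq> basic_construction E"
    unfolding basic_construction_def hull_def
  proof (intro subsetI InterI, clarify)
    fix T M
    assume T: "T \<in> adjointable E" and M: "operator_cstar_algebra E M"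
      and sub: "insert (jones_projection E) (range left_mult) \<subseteq> M"
    have comp: "R \<circ> S \<in> M" and add: "op_add R S \<in> M" if "R \<in> M" "S \<in> M" for R S
      using M that by (auto simp: operator_cstar_algebra_def)
    have rank_one: "(\<lambda>x. b * E (c * x)) \<in> M" for b c
    proof -
      have "left_mult b \<circ> jones_projection E \<circ> left_mult c \<in> M"
        using sub by (intro comp) auto
      then show ?thesis
        by (simp add: left_mult_def jones_projection_def comp_def)
    qed
    have span: "(\<lambda>x. \<Sum>(u, v)\<leftarrow>l. T u * E (v * x)) \<in> M" for l
    proof (induction l)
      case Nil
      then show ?case using M by (simp add: operator_cstar_algebra_def)
    next
      case (Cons uv l)
      then show ?case
        using add[OF rank_one[of "T (fst uv)" "snd uv"] Cons.IH]
        by (simp add: op_add_def split_def)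
    qed
    obtain uvs where "quasi_basis E uvs"
      using finite_index by (auto simp: index_finite_def)
    with T have "T = (\<lambda>x. \<Sum>(u, v)\<leftarrow>uvs. T u * E (v * x))"
      by (intro ext adjointable_expansion)
    with span show "T \<in> M" by metis
  qed
qed

text \<open>Independence of the quasi-basis: expand each \<open>s\<close> by \<open>uvs\<close>,
  exchange the sums, and recollect each \<open>v\<close> by the right-hand expansion in the chosen
  family \<open>sts\<close>.\<close>

lemma Index_eq:
  assumes "quasi_basis E uvs"
  shows "Index E = (\<Sum>(u, v)\<leftarrow>uvs. u * v)"
proof -
  define sts where "sts = (SOME sts. quasi_basis E sts)"
  have sts: "quasi_basis E sts"
    unfolding sts_def using assms by (rule someI)
  have "(\<Sum>(s, t)\<leftarrow>sts. s * t) = (\<Sum>p\<leftarrow>sts. (\<Sum>q\<leftarrow>uvs. fst q * E (snd q * fst p)) * snd p)"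
    using assms by (simp add: quasi_basis_def split_def)
  also have "\<dots> = (\<Sum>p\<leftarrow>sts. \<Sum>q\<leftarrow>uvs. fst q * E (snd q * fst p) * snd p)"
    by (simp add: sum_list_mult_const)
  also have "\<dots> = (\<Sum>q\<leftarrow>uvs. \<Sum>p\<leftarrow>sts. fst q * E (snd q * fst p) * snd p)"
    by (rule sum_list_swap)
  also have "\<dots> = (\<Sum>q\<leftarrow>uvs. fst q * (\<Sum>p\<leftarrow>sts. E (snd q * fst p) * snd p))"
    by (simp add: sum_list_const_mult mult.assoc)
  also have "\<dots> = (\<Sum>(u, v)\<leftarrow>uvs. u * v)"
    using sts by (simp add: quasi_basis_def split_def)
  finally show ?thesis by (simp add: Index_def sts_def)
qed

section \<open>From each condition to a unitary quasi-basis\<close>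

text \<open>The index gives \<open>u * u\<^sup>\<star> = 1\<close>, so \<open>p = 1 - u\<^sup>\<star> * u\<close> is a projection with \<open>E p = 0\<close>; expanding
  \<open>p = u * b\<close> with \<open>b \<in> A\<close>, this reads \<open>b\<^sup>\<star> * b = 0\<close>.\<close>

lemma unitary_quasi_basis:
  assumes two: "Index E = 2" and norm: "E (u\<^sup>\<star> * u) = 1"
    and expand: "\<And>x. x = E x + u * E (u\<^sup>\<star> * x)"
  shows "unitary u \<and> quasi_basis E [(1, 1), (u, u\<^sup>\<star>)]"
proof -
  have "x = E x + E (x * u) * u\<^sup>\<star>" for x
  proof -
    \<comment> \<open>The right-hand half of the quasi-basis identity is the star of the left-hand
      half at \<open>x\<^sup>\<star>\<close>.\<close>
    have "(x\<^sup>\<star>)\<^sup>\<star> = (E (x\<^sup>\<star>) + u * E (u\<^sup>\<star> * x\<^sup>\<star>))\<^sup>\<star>"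
      by (rule arg_cong[OF expand])
    then show ?thesis
      by (simp add: star_add star_mult star_star E_star[symmetric])
  qed
  with expand have qb: "quasi_basis E [(1, 1), (u, u\<^sup>\<star>)]"
    by (simp add: quasi_basis_def)
  have "1 + u * u\<^sup>\<star> = 1 + 1"
    using Index_eq[OF qb] two by simp
  then have co: "u * u\<^sup>\<star> = 1"
    by (rule add_left_imp_eq)
  define p where "p = 1 - u\<^sup>\<star> * u"
  define b where "b = E (u\<^sup>\<star> * p)"
  have "u * (u\<^sup>\<star> * x) = x" for x
    by (simp add: mult.assoc[symmetric] co)
  then have proj: "p\<^sup>\<star> * p = p"
    by (simp add: p_def star_diff star_one star_mult star_star algebra_simps)
  have Ep: "E p = 0"
    by (simp add: p_def norm)
  then have pb: "p = u * b"
    using expand[of p, symmetric] by (simp add: b_def)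
  have "b\<^sup>\<star> * b = E (b\<^sup>\<star> * (u\<^sup>\<star> * u) * b)"
    by (simp add: b_def norm)
  also have "b\<^sup>\<star> * (u\<^sup>\<star> * u) * b = p\<^sup>\<star> * p"
    by (simp add: pb star_mult mult.assoc)
  finally have "b\<^sup>\<star> * b = 0"
    by (simp only: proj Ep)
  then have "b = 0"
    using norm_star_mult_self[of b] by simp
  with pb have "u\<^sup>\<star> * u = 1" by (simp add: p_def)
  with co qb show ?thesis by (simp add: unitary_def)
qed

text \<open>The point is that \<open>v = u e\<^sub>A\<close> with \<open>u = v 1\<close>; then
  \<open>v\<^sup>\<star> v = e\<^sub>A\<close> gives the normalization and
  \<open>v v\<^sup>\<star> = 1 - e\<^sub>A\<close> the expansion.\<close>

lemma mvn_equivalent_imp_unitary: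
  assumes two: "Index E = 2"
    and mvn: "murray_von_neumann_equivalent E (basic_construction E)
      (jones_projection E) (jones_complement E)"
  shows "\<exists>u. unitary u \<and> quasi_basis E [(1, 1), (u, u\<^sup>\<star>)]"
proof -
  obtain v where v: "v \<in> adjointable E" and "adj E v \<circ> v = jones_projection E"
    and "v \<circ> adj E v = jones_complement E"
    using mvn by (auto simp: murray_von_neumann_equivalent_def basic_construction_eq)
  then have 1: "adj E v (v x) = E x" and 2: "v (adj E v x) = x - E x" for x
    by (auto simp: fun_eq_iff jones_projection_def complement_apply)
  define u where "u = v 1"
  have adjv: "hm_inner E (v x) y = hm_inner E x (adj E v y)" for x y
    using is_adjoint_adj[OF v] by (simp add: is_adjoint_def)
  have v_eq: "v x = u * E x" for x
  proof -
    \<comment> \<open>Evaluate \<open>v v\<^sup>\<star> v x\<close> in two ways.\<close>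
    have "v x - E (v x) = v (E x)" using 2[of "v x"] by (simp add: 1)
    moreover have "v (E x) = u * E x" using adjointable_on_A[OF v, of "E x"] by (simp add: u_def)
    \<comment> \<open>By the same evaluation \<open>E (v x) = v (x - E x)\<close>. Moving
      \<open>v\<close> across the pairing with \<open>v x\<close> produces
      \<open>E (x - E x) = 0\<close>, so this element has norm zero.\<close>
    moreover have "E (v x) = 0"
    proof -
      have "v (x - E x) = E (v x)"
        using 2[of "v x"] adjointable_linear(1)[OF v, of "x - E x" "E x"] by (simp add: 1)
      then have "(E (v x))\<^sup>\<star> * E (v x) = hm_inner E (v x) (v (x - E x))"
        by (simp add: hm_inner_def E_star[symmetric])
      also have "\<dots> = 0"
        unfolding adjv by (simp add: 1 hm_inner_def)
      finally show ?thesis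
        using norm_star_mult_self[of "E (v x)"] by simp
    qed
    ultimately show ?thesis by simp
  qed
  have adjv_eq: "adj E v y = E (u\<^sup>\<star> * y)" for y
  proof (rule hm_inner_eqI)
    show "hm_inner E x (adj E v y) = hm_inner E x (E (u\<^sup>\<star> * y))" for x
      unfolding adjv[symmetric]
      by (simp add: v_eq hm_inner_def star_mult E_star[symmetric] mult.assoc)
  qed
  have "E (u\<^sup>\<star> * u) = 1"
    using 1[of 1] by (simp add: adjv_eq u_def[symmetric])
  moreover have "x = E x + u * E (u\<^sup>\<star> * x)" for x
    using 2[of x] by (simp add: adjv_eq v_eq)
  ultimately show ?thesis
    using unitary_quasi_basis[OF two] by blast
qed

text \<open>The vector \<open>w = \<rho> 1\<close> generates the corner as a left
  \<open>A\<close>-module. Its adjoint has the form \<open>u e\<^sub>A\<close>; the left inner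
  product of \<open>w\<close> with itself normalizes \<open>u\<close>, and surjectivity of
  \<open>\<rho>\<close> yields the expansion.\<close>

lemma bimodule_iso_imp_unitary:
  assumes two: "Index E = 2"
    and iso: "involutive_bimodule_iso A (bimodule_of_automorphism A \<alpha> z) (bimodule_of_inclusion A E)"
  shows "\<exists>u. unitary u \<and> quasi_basis E [(1, 1), (u, u\<^sup>\<star>)]"
proof -
  let ?X = "bimodule_of_inclusion A E"
  obtain \<rho> where bij: "bij_betw \<rho> A (vectors ?X)"
    and act: "\<And>a. a \<in> A \<Longrightarrow> \<rho> a = left_mult a \<circ> \<rho> 1"
    and inner: "linner ?X (\<rho> 1) (\<rho> 1) = 1"
  proof -
    obtain \<rho> where \<rho>: "bij_betw \<rho> A (vectors ?X)"
      "\<And>a x. a \<in> A \<Longrightarrow> x \<in> A \<Longrightarrow> \<rho> (a * x) = left_mult a \<circ> \<rho> x"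
      "\<And>x y. x \<in> A \<Longrightarrow> y \<in> A \<Longrightarrow> linner ?X (\<rho> x) (\<rho> y) = x * y\<^sup>\<star>"
      using iso unfolding involutive_bimodule_iso_def
      by (auto simp: bimodule_of_automorphism_def bimodule_of_inclusion_def)
    show thesis
    proof (rule that[of \<rho>])
      show "\<rho> a = left_mult a \<circ> \<rho> 1" if "a \<in> A" for a
        using \<rho>(2)[OF that, of 1] by simp
      show "linner ?X (\<rho> 1) (\<rho> 1) = 1"
        using \<rho>(3)[of 1 1] by (simp add: star_one)
    qed (fact \<rho>(1))
  qed
  define w where "w = \<rho> 1"
  obtain T where T: "T \<in> adjointable E"
    and w_eq: "w = jones_projection E \<circ> T \<circ> jones_complement E"
    using bspec[OF bij_betwE[OF bij] A_simps(1)]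
    by (auto simp: w_def bimodule_of_inclusion_def basic_construction_eq)
  have w: "w \<in> adjointable E"
    using is_adjoint_comp[OF is_adjoint_comp[OF is_adjoint_jones is_adjoint_adj[OF T]]
        is_adjoint_complement]
    by (auto simp: adjointable_def w_eq)
  have wA: "w a = 0" if "a \<in> A" for a
    using that by (simp add: w_eq complement_apply adjointable_zero[OF T] jones_projection_def)
  have "w x \<in> A" for x
    by (simp add: w_eq jones_projection_def)
  define v where "v = adj E w"
  have wv: "hm_inner E (w x) y = hm_inner E x (v y)" for x y
    using is_adjoint_adj[OF w] by (simp add: is_adjoint_def v_def)
  have v: "v \<in> adjointable E"
    using is_adjoint_sym[OF is_adjoint_adj[OF w]] by (auto simp: v_def adjointable_def)
  define u where "u = v 1"
  have v_eq: "v y = u * E y" for y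
  proof -
    have "v y = v (E y)"
      by (rule hm_inner_eqI)
        (simp add: wv[symmetric], simp add: hm_inner_def w_eq jones_projection_def E_star[symmetric])
    then show ?thesis using adjointable_on_A[OF v, of "E y"] by (simp add: u_def)
  qed
  have w_u: "w y = E (u\<^sup>\<star> * y)" for y
  proof (rule hm_inner_eqI)
    fix x
    have "hm_inner E x (w y) = (hm_inner E (w y) x)\<^sup>\<star>"
      by (simp add: hm_inner_def E_star[symmetric] star_mult star_star)
    also have "\<dots> = hm_inner E x (E (u\<^sup>\<star> * y))"
      unfolding wv by (simp add: v_eq hm_inner_def E_star[symmetric] star_mult star_star mult.assoc[symmetric])
    finally show "hm_inner E x (w y) = hm_inner E x (E (u\<^sup>\<star> * y))" .
  qed
  have norm: "E (u\<^sup>\<star> * u) = 1"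
  proof -
    \<comment> \<open>Right \<open>A\<close>-linearity of \<open>w\<close> gives
      \<open>w w\<^sup>\<star> = (w u) e\<^sub>A\<close>, and evaluation at \<open>1\<close> shows
      that the coefficient is unique. So the inner product is
      \<open>w u = E (u\<^sup>\<star> * u)\<close>.\<close>
    have "left_mult (w u) \<circ> jones_projection E = w \<circ> adj E w"
      by (auto simp: fun_eq_iff left_mult_def jones_projection_def v_def[symmetric] v_eq
          adjointable_linear(2)[OF w])
    moreover have "c = w u" if "left_mult c \<circ> jones_projection E = w \<circ> adj E w" for c
      using fun_cong[OF that, of 1] by (simp add: left_mult_def jones_projection_def v_def[symmetric] v_eq)
    ultimately have "(THE c. c \<in> A \<and> left_mult c \<circ> jones_projection E = w \<circ> adj E w) = w u"
      using \<open>w u \<in> A\<close> by (intro the_equality conjI) blast+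
    with inner show ?thesis by (simp add: bimodule_of_inclusion_def w_def[symmetric] w_u)
  qed
  have Eu: "E (u\<^sup>\<star>) = 0"
    using wA[of 1] by (simp add: w_u)
  have "x = E x + u * E (u\<^sup>\<star> * x)" for x
  proof -
    define c where "c = x - E x"
    have Ec: "E c = 0" "E (c\<^sup>\<star>) = 0"
      by (simp_all add: c_def E_star star_zero)
    \<comment> \<open>The corner vector \<open>e\<^sub>A c\<^sup>\<star> (1 - e\<^sub>A)\<close>
      must be a multiple \<open>a w\<close>. Comparing the two as functionals on \<open>B\<close>
      gives \<open>c = u * a\<^sup>\<star>\<close>.\<close>
    have "left_mult (c\<^sup>\<star>) \<in> adjointable E"
      using is_adjoint_left_mult by (auto simp: adjointable_def)
    then have "jones_projection E \<circ> left_mult (c\<^sup>\<star>) \<circ> jones_complement E \<in> \<rho> ` A"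
      using bij by (auto simp: bij_betw_def bimodule_of_inclusion_def basic_construction_eq)
    then obtain a where a: "a \<in> A"
      and eq: "jones_projection E \<circ> left_mult (c\<^sup>\<star>) \<circ> jones_complement E = left_mult a \<circ> w"
      unfolding w_def by (metis act imageE)
    have *: "E (c\<^sup>\<star> * y) = a * E (u\<^sup>\<star> * y)" for y
      using fun_cong[OF eq, of y]
      by (simp add: left_mult_def jones_projection_def complement_apply w_u
          right_diff_distrib Ec)
    have "hm_inner E y c = hm_inner E y (u * a\<^sup>\<star>)" for y
      using arg_cong[OF *[of y], of star] a
      by (simp add: hm_inner_def E_star[symmetric] star_mult star_star mult.assoc[symmetric])
    then have c: "c = u * a\<^sup>\<star>" by (rule hm_inner_eqI)
    \<comment> \<open>The coefficient \<open>a\<^sup>\<star>\<close> is recovered as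
      \<open>E (u\<^sup>\<star> * x)\<close>.\<close>
    have "E (u\<^sup>\<star> * x) = E (u\<^sup>\<star> * c)"
      by (simp add: c_def right_diff_distrib Eu)
    also have "\<dots> = a\<^sup>\<star>"
      using a by (simp add: c mult.assoc[symmetric] norm)
    finally show ?thesis
      using c by (simp add: c_def algebra_simps)
  qed
  then show ?thesis using unitary_quasi_basis[OF two norm] by blast
qed

end

section \<open>Consequences of a unitary quasi-basis\<close>

locale unitary_quasi_basis = finite_index_cond_exp A E
  for A :: "'b::unital_cstar_algebra set" and E +
  fixes u :: 'b
  assumes unitary: "unitary u" and quasi_basis: "quasi_basis E [(1, 1), (u, u\<^sup>\<star>)]"
begin

lemma uu [simp]: "u\<^sup>\<star> * u = 1" "u * u\<^sup>\<star> = 1" "u\<^sup>\<star> * (u * x) = x" "u * (u\<^sup>\<star> * x) = x"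
  using unitary by (simp_all add: unitary_def mult.assoc[symmetric])

text \<open>As an operator identity the first half reads
  \<open>u e\<^sub>A u\<^sup>\<star> = 1 - e\<^sub>A\<close>.\<close>

lemma expand_left: "u * E (u\<^sup>\<star> * x) = x - E x"
  and expand_right: "E (x * u) * u\<^sup>\<star> = x - E x"
proof -
  have "x = E x + u * E (u\<^sup>\<star> * x)" "x = E x + E (x * u) * u\<^sup>\<star>"
    using quasi_basis by (simp_all add: quasi_basis_def)
  from this[symmetric] show "u * E (u\<^sup>\<star> * x) = x - E x" "E (x * u) * u\<^sup>\<star> = x - E x"
    by (simp_all only: eq_diff_eq add.commute)
qed

text \<open>Expand \<open>1\<close>: the remainder \<open>u * E (u\<^sup>\<star>)\<close> vanishes,
  and \<open>u\<close> is invertible.\<close>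

lemma E_u [simp]: "E (u\<^sup>\<star>) = 0" "E u = 0"
proof -
  have "u\<^sup>\<star> * (u * E (u\<^sup>\<star> * 1)) = 0" by (simp only: expand_left) simp
  then show "E (u\<^sup>\<star>) = 0" by simp
  then show "E u = 0" by (metis E_star star_star star_zero)
qed

text \<open>The quantity \<open>E (u\<^sup>\<star> * x)\<close> is the coefficient of
  \<open>x\<close> along \<open>u\<close>. It serves as the membership test for \<open>u * u\<close>
  and for conjugates of \<open>A\<close>.\<close>

lemma in_A_iff: "x \<in> A \<longleftrightarrow> E (u\<^sup>\<star> * x) = 0"
proof
  show "E (u\<^sup>\<star> * x) = 0 \<Longrightarrow> x \<in> A"
    using expand_left[of x] by (metis E_simps(3) eq_iff_diff_eq_0 mult_zero_right)
qed simp

lemma u_square [simp]: "u * u \<in> A"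
  unfolding in_A_iff by simp

lemma u_star_square [simp]: "u\<^sup>\<star> * u\<^sup>\<star> \<in> A"
  using A_simps(5)[OF u_square] by (simp add: star_mult)

lemma conj_in_A [simp]: "a \<in> A \<Longrightarrow> u * a * u\<^sup>\<star> \<in> A"
  by (subst in_A_iff) (simp add: mult.assoc)

lemma conj_in_A' [simp]: "a \<in> A \<Longrightarrow> u\<^sup>\<star> * a * u \<in> A"
proof -
  assume a: "a \<in> A"
  \<comment> \<open>As \<open>u * u\<close> lies in \<open>A\<close>, conjugation by
    \<open>u\<^sup>\<star>\<close> reduces to conjugation by \<open>u\<close>.\<close>
  have "u\<^sup>\<star> * a * u = (u * u)\<^sup>\<star> * (u * a * u\<^sup>\<star>) * (u * u)"
    by (simp add: star_mult mult.assoc)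
  with a show ?thesis by (metis A_simps(3,5) conj_in_A u_square)
qed

text \<open>Split \<open>x = E x + u * a\<close> with \<open>a\<close> in \<open>A\<close>.
  Conjugation keeps the first term in \<open>A\<close> and sends the second to
  \<open>(u * u) * a * u\<^sup>\<star>\<close>, which \<open>E\<close> kills.\<close>

lemma E_conj: "E (u * x * u\<^sup>\<star>) = u * E x * u\<^sup>\<star>"
proof -
  define a where "a = E (u\<^sup>\<star> * x)"
  have x: "x = E x + u * a" unfolding a_def expand_left by simp
  have "E (u * (u * a) * u\<^sup>\<star>) = E (u * u * a * u\<^sup>\<star>)"
    by (simp add: mult.assoc)
  also have "\<dots> = 0" by (simp add: a_def)
  finally have "E (u * (E x + u * a) * u\<^sup>\<star>) = u * E x * u\<^sup>\<star>"
    by (simp add: distrib_left distrib_right)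
  then show ?thesis unfolding x[symmetric] .
qed

lemma E_conj': "E (u\<^sup>\<star> * x * u) = u\<^sup>\<star> * E x * u"
proof -
  have "u * (u\<^sup>\<star> * x * u) * u\<^sup>\<star> = x"
    by (simp add: mult.assoc)
  then have "u\<^sup>\<star> * E x * u = u\<^sup>\<star> * (u * E (u\<^sup>\<star> * x * u) * u\<^sup>\<star>) * u"
    by (metis E_conj)
  also have "\<dots> = E (u\<^sup>\<star> * x * u)"
    by (simp add: mult.assoc)
  finally show ?thesis ..
qed

section \<open>The dual automorphism\<close>

text \<open>Right multiplication with \<open>u\<^sup>\<star>\<close> commutes with left multiplications, and the second half
  of the quasi-basis identity says that conjugation by it carries \<open>E\<close> to \<open>1 - E\<close>.\<close>

definition dual :: "('b \<Rightarrow> 'b) \<Rightarrow> 'b \<Rightarrow> 'b" where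
  "dual T = (\<lambda>x. T (x * u) * u\<^sup>\<star>)"

lemma dual_left_mult: "dual (left_mult b) = left_mult b"
  by (simp add: dual_def left_mult_def mult.assoc)

lemma dual_jones: "dual (jones_projection E) = jones_complement E"
  by (simp add: fun_eq_iff dual_def jones_projection_def complement_apply expand_right)

text \<open>Conjugation by \<open>u\<close> commutes with \<open>E\<close>, so right multiplication
  by \<open>u\<close> changes both sides of the adjoint relation by the same conjugation.\<close>

lemma is_adjoint_dual: "is_adjoint E T S \<Longrightarrow> is_adjoint E (dual T) (dual S)"
proof -
  assume "is_adjoint E T S"
  then have TS: "E ((T x)\<^sup>\<star> * y) = E (x\<^sup>\<star> * S y)" for x y
    by (simp add: is_adjoint_def hm_inner_def)
  have "E ((dual T x)\<^sup>\<star> * y) = E (x\<^sup>\<star> * dual S y)" for x y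
  proof -
    have "E ((dual T x)\<^sup>\<star> * y) = E (u * ((T (x * u))\<^sup>\<star> * (y * u)) * u\<^sup>\<star>)"
      by (simp add: dual_def star_mult star_star mult.assoc)
    also have "\<dots> = E (u * ((x * u)\<^sup>\<star> * S (y * u)) * u\<^sup>\<star>)"
      by (simp only: E_conj TS)
    also have "\<dots> = E (x\<^sup>\<star> * dual S y)"
      by (simp add: dual_def star_mult mult.assoc)
    finally show ?thesis .
  qed
  then show ?thesis by (simp add: is_adjoint_def hm_inner_def)
qed

lemma is_adjoint_dual_inv:
  assumes "is_adjoint E T S"
  shows "is_adjoint E (\<lambda>x. T (x * u\<^sup>\<star>) * u) (\<lambda>x. S (x * u\<^sup>\<star>) * u)"
proof -
  have TS: "E ((T x)\<^sup>\<star> * y) = E (x\<^sup>\<star> * S y)" for x y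
    using assms by (simp add: is_adjoint_def hm_inner_def)
  have "E ((T (x * u\<^sup>\<star>) * u)\<^sup>\<star> * y) = E (x\<^sup>\<star> * (S (y * u\<^sup>\<star>) * u))" for x y
  proof -
    have "E ((T (x * u\<^sup>\<star>) * u)\<^sup>\<star> * y) = E (u\<^sup>\<star> * ((T (x * u\<^sup>\<star>))\<^sup>\<star> * (y * u\<^sup>\<star>)) * u)"
      by (simp add: star_mult mult.assoc)
    also have "\<dots> = E (u\<^sup>\<star> * ((x * u\<^sup>\<star>)\<^sup>\<star> * S (y * u\<^sup>\<star>)) * u)"
      by (simp only: E_conj' TS)
    also have "\<dots> = E (x\<^sup>\<star> * (S (y * u\<^sup>\<star>) * u))"
      by (simp add: star_mult star_star mult.assoc)
    finally show ?thesis .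
  qed
  then show ?thesis by (simp add: is_adjoint_def hm_inner_def)
qed

lemma star_automorphism_dual:
  "star_automorphism (basic_construction E) op_add op_scale (\<circ>) (adj E) dual"
  unfolding star_automorphism_def basic_construction_eq
proof (intro conjI ballI allI)
  show "bij_betw dual (adjointable E) (adjointable E)"
    by (rule bij_betw_byWitness[where f' = "\<lambda>T x. T (x * u\<^sup>\<star>) * u"])
      (auto simp: dual_def mult.assoc adjointable_def
        intro: is_adjoint_dual[unfolded dual_def] is_adjoint_dual_inv)
  show "dual (adj E T) = adj E (dual T)" if "T \<in> adjointable E" for T
    using adj_eqI[OF is_adjoint_dual[OF is_adjoint_adj[OF that]]] by simp
qed (simp_all add: fun_eq_iff dual_def op_add_def op_scale_def distrib_right mult_scaleC_left mult.assoc)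

text \<open>The map \<open>dual\<close> witnesses existence, so the chosen map has the defining
  properties; the sequel relies on these alone.\<close>

lemma beta_hat:
  "star_automorphism (basic_construction E) op_add op_scale (\<circ>) (adj E) (beta_hat E)"
  "beta_hat E (left_mult b) = left_mult b"
  "beta_hat E (jones_projection E) = jones_complement E"
proof -
  have "star_automorphism (basic_construction E) op_add op_scale (\<circ>) (adj E) (beta_hat E) \<and>
     (\<forall>b. beta_hat E (left_mult b) = left_mult b) \<and>
     beta_hat E (jones_projection E) = jones_complement E"
    unfolding beta_hat_def
    by (rule someI[where x = dual]) (intro conjI allI star_automorphism_dual dual_left_mult dual_jones)
  then show "star_automorphism (basic_construction E) op_add op_scale (\<circ>) (adj E) (beta_hat E)"
    "beta_hat E (left_mult b) = left_mult b"
    "beta_hat E (jones_projection E) = jones_complement E" by blast+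
qed

text \<open>Adjoints of vectors in the corner have the form \<open>b e\<^sub>A\<close>, so this
  value determines the involution.\<close>

lemma beta_hat_left_mult_jones:
  "beta_hat E (left_mult b \<circ> jones_projection E) = left_mult b \<circ> jones_complement E"
proof -
  have "left_mult b \<in> basic_construction E" "jones_projection E \<in> basic_construction E"
    unfolding basic_construction_eq
    by (rule adjointableI, rule is_adjoint_left_mult is_adjoint_jones)+
  with beta_hat show ?thesis by (simp add: star_automorphism_def)
qed

section \<open>From a unitary quasi-basis to the other conditions\<close>

lemma mvn_equivalent:
  "murray_von_neumann_equivalent E (basic_construction E) (jones_projection E) (jones_complement E)"
proof -
  let ?v = "left_mult u \<circ> jones_projection E"
  have v: "is_adjoint E ?v (jones_projection E \<circ> left_mult (u\<^sup>\<star>))"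
    by (intro is_adjoint_comp is_adjoint_left_mult is_adjoint_jones)
  have "adj E ?v \<circ> ?v = jones_projection E" "?v \<circ> adj E ?v = jones_complement E"
    unfolding adj_eqI[OF v]
    by (simp_all add: fun_eq_iff left_mult_def jones_projection_def complement_apply expand_left)
  moreover have "?v \<in> basic_construction E"
    using v by (auto simp: basic_construction_eq adjointable_def)
  ultimately show ?thesis by (auto simp: murray_von_neumann_equivalent_def)
qed

text \<open>The direction of conjugation is dictated by the right action:
  \<open>u\<^sup>\<star> * a = conj_u a * u\<^sup>\<star>\<close> moves \<open>a\<close> past
  \<open>u\<^sup>\<star>\<close>.\<close>

definition conj_u :: "'b \<Rightarrow> 'b" where
  "conj_u a = u\<^sup>\<star> * a * u"

lemma bij_conj_u: "bij_betw conj_u A A"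
proof (rule bij_betw_byWitness[where f' = "\<lambda>a. u * a * u\<^sup>\<star>"])
  show "\<forall>a\<in>A. u * conj_u a * u\<^sup>\<star> = a" "\<forall>a\<in>A. conj_u (u * a * u\<^sup>\<star>) = a"
    by (simp_all add: conj_u_def mult.assoc)
  show "conj_u ` A \<subseteq> A" "(\<lambda>a. u * a * u\<^sup>\<star>) ` A \<subseteq> A"
    by (auto simp: conj_u_def)
qed

lemma two_Z_inner_conj: "two_Z_inner_system A conj_u ((u * u)\<^sup>\<star>)"
  unfolding two_Z_inner_system_def star_automorphism_def
proof (intro conjI ballI allI)
  show "bij_betw conj_u A A"
    by (rule bij_conj_u)
  show "unitary ((u * u)\<^sup>\<star>)"
    by (simp add: unitary_def star_mult star_star mult.assoc)
qed (simp_all add: conj_u_def star_mult star_star mult.assoc distrib_left distrib_right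
    mult_scaleC_left mult_scaleC_right)

lemma the_inv_conj: "a \<in> A \<Longrightarrow> the_inv_into A conj_u a = u * a * u\<^sup>\<star>"
proof (rule the_inv_into_f_eq)
  show "conj_u (u * a * u\<^sup>\<star>) = a"
    by (simp add: conj_u_def mult.assoc)
qed (use bij_conj_u in \<open>simp_all add: bij_betw_def\<close>)

lemma bimodule_iso:
  "involutive_bimodule_iso A (bimodule_of_automorphism A conj_u ((u * u)\<^sup>\<star>)) (bimodule_of_inclusion A E)"
proof -
  \<comment> \<open>For \<open>a\<close> in \<open>A\<close> this is
    \<open>e\<^sub>A a u\<^sup>\<star>\<close>. Evaluation at \<open>u\<close> recovers
    \<open>a\<close>, hence injectivity.\<close>
  define \<rho> where "\<rho> a = (\<lambda>x. a * E (u\<^sup>\<star> * x))" for a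
  have \<rho>_u: "\<rho> a u = a" for a
    by (simp add: \<rho>_def)
  have \<rho>_eq: "\<rho> a = jones_projection E \<circ> left_mult (a * u\<^sup>\<star>)" if "a \<in> A" for a
    using that by (simp add: fun_eq_iff \<rho>_def jones_projection_def left_mult_def mult.assoc)
  have adj_\<rho>: "adj E (\<rho> a) = left_mult (u * a\<^sup>\<star>) \<circ> jones_projection E" if "a \<in> A" for a
    using adj_eqI[OF is_adjoint_comp[OF is_adjoint_jones is_adjoint_left_mult[of "a * u\<^sup>\<star>"]]] that
    by (simp add: \<rho>_eq star_mult star_star)
  \<comment> \<open>Surjectivity: \<open>1 - e\<^sub>A\<close> has values
    \<open>u * E (u\<^sup>\<star> * x)\<close>, so the corner of \<open>T\<close> depends only on
    \<open>E (T u)\<close>.\<close>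
  have corner: "jones_projection E \<circ> T \<circ> jones_complement E = \<rho> (E (T u))"
    if T: "T \<in> adjointable E" for T
  proof
    fix x
    have "T (x - E x) = T u * E (u\<^sup>\<star> * x)"
      unfolding expand_left[symmetric] by (rule adjointable_linear(2)[OF T]) simp
    then show "(jones_projection E \<circ> T \<circ> jones_complement E) x = \<rho> (E (T u)) x"
      by (simp add: jones_projection_def complement_apply \<rho>_def)
  qed
  have "bij_betw \<rho> A {jones_projection E \<circ> T \<circ> jones_complement E |T. T \<in> basic_construction E}"
  proof (rule bij_betwI')
    show "\<rho> a = \<rho> b \<longleftrightarrow> a = b" for a b by (metis \<rho>_u)
    show "\<rho> a \<in> {jones_projection E \<circ> T \<circ> jones_complement E |T. T \<in> basic_construction E}"
      if "a \<in> A" for a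
    proof -
      have T: "left_mult (a * u\<^sup>\<star>) \<in> adjointable E"
        using is_adjoint_left_mult by (auto simp: adjointable_def)
      have "\<rho> a = \<rho> (E (left_mult (a * u\<^sup>\<star>) u))"
        using that by (simp add: left_mult_def mult.assoc)
      with corner[OF T] T show ?thesis
        unfolding basic_construction_eq by (intro CollectI exI[of _ "left_mult (a * u\<^sup>\<star>)"]) simp
    qed
    show "\<exists>a\<in>A. S = \<rho> a"
      if S: "S \<in> {jones_projection E \<circ> T \<circ> jones_complement E |T. T \<in> basic_construction E}" for S
    proof -
      obtain T where T: "T \<in> adjointable E"
        and eq: "S = jones_projection E \<circ> T \<circ> jones_complement E"
        using S unfolding basic_construction_eq by blast
      show ?thesis
        unfolding eq corner[OF T] by (intro bexI[of _ "E (T u)"]) simp_all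
    qed
  qed
  moreover have "\<rho> (x + y) = op_add (\<rho> x) (\<rho> y)" for x y
    by (simp add: \<rho>_def op_add_def distrib_right)
  moreover have "\<rho> (c *\<^sub>C x) = op_scale c (\<rho> x)" for c x
    by (simp add: \<rho>_def op_scale_def mult_scaleC_left)
  moreover have "\<rho> (a * x) = left_mult a \<circ> \<rho> x" for a x
    by (simp add: fun_eq_iff \<rho>_def left_mult_def mult.assoc)
  moreover have "\<rho> (x * conj_u a) = \<rho> x \<circ> left_mult a" if "a \<in> A" for a x
  proof
    fix y
    have "conj_u a * E (u\<^sup>\<star> * y) = E (conj_u a * (u\<^sup>\<star> * y))"
      using that by (simp add: conj_u_def)
    then show "\<rho> (x * conj_u a) y = (\<rho> x \<circ> left_mult a) y"
      by (simp add: \<rho>_def left_mult_def conj_u_def mult.assoc)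
  qed
  moreover have "(THE c. c \<in> A \<and> left_mult c \<circ> jones_projection E = \<rho> x \<circ> adj E (\<rho> y)) = x * y\<^sup>\<star>"
    if "x \<in> A" "y \<in> A" for x y
  proof -
    have eq: "\<rho> x \<circ> adj E (\<rho> y) = left_mult (x * y\<^sup>\<star>) \<circ> jones_projection E"
      using that by (simp add: fun_eq_iff adj_\<rho>) (simp add: \<rho>_def left_mult_def jones_projection_def mult.assoc)
    show ?thesis
    proof (rule the_equality)
      show "c = x * y\<^sup>\<star>"
        if "c \<in> A \<and> left_mult c \<circ> jones_projection E = \<rho> x \<circ> adj E (\<rho> y)" for c
      proof -
        have "(left_mult c \<circ> jones_projection E) 1 = (left_mult (x * y\<^sup>\<star>) \<circ> jones_projection E) 1"
          using that eq by simp
        then show ?thesis by (simp add: left_mult_def jones_projection_def)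
      qed
    qed (use that eq in simp)
  qed
  moreover have "(THE c. c \<in> A \<and> left_mult c \<circ> jones_complement E = adj E (\<rho> x) \<circ> \<rho> y)
      = the_inv_into A conj_u (x\<^sup>\<star> * y)"
    if "x \<in> A" "y \<in> A" for x y
  proof -
    have inv: "the_inv_into A conj_u (x\<^sup>\<star> * y) = u * (x\<^sup>\<star> * y) * u\<^sup>\<star>"
      using that by (simp add: the_inv_conj)
    \<comment> \<open>Rewriting \<open>1 - e\<^sub>A\<close> as
      \<open>u e\<^sub>A u\<^sup>\<star>\<close> brings both sides to
      \<open>x \<mapsto> b * E (u\<^sup>\<star> * x)\<close>.\<close>
    have eq: "adj E (\<rho> x) \<circ> \<rho> y = left_mult (u * (x\<^sup>\<star> * y) * u\<^sup>\<star>) \<circ> jones_complement E"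
      using that
      by (simp add: fun_eq_iff adj_\<rho> complement_apply flip: expand_left)
        (simp add: \<rho>_def left_mult_def jones_projection_def mult.assoc)
    show ?thesis unfolding inv
    proof (rule the_equality)
      show "c = u * (x\<^sup>\<star> * y) * u\<^sup>\<star>"
        if "c \<in> A \<and> left_mult c \<circ> jones_complement E = adj E (\<rho> x) \<circ> \<rho> y" for c
      proof -
        \<comment> \<open>Here the test vector is \<open>u\<close>, which
          \<open>1 - e\<^sub>A\<close> fixes because \<open>E u = 0\<close>.\<close>
        have "(left_mult c \<circ> jones_complement E) u
            = (left_mult (u * (x\<^sup>\<star> * y) * u\<^sup>\<star>) \<circ> jones_complement E) u"
          using that eq by simp
        then have "c * u = u * (x\<^sup>\<star> * y) * u\<^sup>\<star> * u"
          by (simp add: left_mult_def complement_apply)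
        then have "c * u * u\<^sup>\<star> = u * (x\<^sup>\<star> * y) * u\<^sup>\<star> * u * u\<^sup>\<star>" by simp
        then show ?thesis by (simp add: mult.assoc)
      qed
      have "u * (x\<^sup>\<star> * y) * u\<^sup>\<star> \<in> A" using that by (intro conj_in_A) simp
      with eq show "u * (x\<^sup>\<star> * y) * u\<^sup>\<star> \<in> A \<and>
        left_mult (u * (x\<^sup>\<star> * y) * u\<^sup>\<star>) \<circ> jones_complement E = adj E (\<rho> x) \<circ> \<rho> y" by simp
    qed
  qed
  \<comment> \<open>Both sides are \<open>u x\<^sup>\<star> u e\<^sub>A u\<^sup>\<star>\<close>: on
    the left \<open>z\<^sup>\<star> = u * u\<close> absorbs the \<open>u\<^sup>\<star>\<close> of
    \<open>conj_u\<close>, on the right \<open>u x\<^sup>\<star> e\<^sub>A\<close> becomes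
    \<open>u x\<^sup>\<star> (1 - e\<^sub>A)\<close>.\<close>
  moreover have "\<rho> (((u * u)\<^sup>\<star>)\<^sup>\<star> * conj_u (x\<^sup>\<star>)) = beta_hat E (adj E (\<rho> x))" if "x \<in> A" for x
    unfolding adj_\<rho>[OF that] beta_hat_left_mult_jones
    by (simp add: fun_eq_iff complement_apply left_mult_def conj_u_def star_star flip: expand_left)
      (simp add: \<rho>_def mult.assoc)
  ultimately show ?thesis
    unfolding involutive_bimodule_iso_def
    by (intro exI[of _ \<rho>]) (simp add: bimodule_of_automorphism_def bimodule_of_inclusion_def)
qed

end

theorem proposition4p1p2:
  fixes A :: "'b::unital_cstar_algebra set" and E :: "'b \<Rightarrow> 'b"
  assumes "unital_cstar_subalgebra A"
    and "conditional_expectation A E"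
    and "index_finite E" and "Index E = 2"
  shows "(murray_von_neumann_equivalent E (basic_construction E)
            (jones_projection E) (jones_complement E)
          \<longleftrightarrow> (\<exists>u::'b. unitary u \<and> quasi_basis E [(1, 1), (u, u\<^sup>\<star>)]))
       \<and> ((\<exists>u::'b. unitary u \<and> quasi_basis E [(1, 1), (u, u\<^sup>\<star>)])
          \<longleftrightarrow> (\<exists>\<alpha> z. two_Z_inner_system A \<alpha> z \<and>
                 involutive_bimodule_iso A
                   (bimodule_of_automorphism A \<alpha> z) (bimodule_of_inclusion A E)))"
proof -
  interpret finite_index_cond_exp A E
    using assms by unfold_locales
  have from_u: "murray_von_neumann_equivalent E (basic_construction E)
        (jones_projection E) (jones_complement E)"
    "\<exists>\<alpha> z. two_Z_inner_system A \<alpha> z \<and>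
        involutive_bimodule_iso A (bimodule_of_automorphism A \<alpha> z) (bimodule_of_inclusion A E)"
    if "unitary u" "quasi_basis E [(1, 1), (u, u\<^sup>\<star>)]" for u
  proof -
    interpret unitary_quasi_basis A E u
      using that by unfold_locales
    show "murray_von_neumann_equivalent E (basic_construction E)
        (jones_projection E) (jones_complement E)"
      by (rule mvn_equivalent)
    show "\<exists>\<alpha> z. two_Z_inner_system A \<alpha> z \<and>
        involutive_bimodule_iso A (bimodule_of_automorphism A \<alpha> z) (bimodule_of_inclusion A E)"
      using two_Z_inner_conj bimodule_iso by blast
  qed
  show ?thesis
    using from_u mvn_equivalent_imp_unitary[OF \<open>Index E = 2\<close>]
      bimodule_iso_imp_unitary[OF \<open>Index E = 2\<close>] by blast
qed

end
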